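(* Let $d\ge1$ and consider the rotor-router growth model on $\mathbb{Z}^d$ with a total ordering of $E_d=\{\pm e_1,\dots,\pm e_d\}$ satisfying (i) $e_1<e_2<\dots<e_d$ and (ii) $e_i<-e_i$ for $i=1,\dots,d$. For every $n\ge1$, let $c=(c_1,\dots,c_d)$ be the center of mass (average position) of the set of occupied sites after $n$ particles have been deposited and allowed to equilibrate. Then $0\le c_i\le 1$ for all $i$. Moreover, if $C\subset\{1,\dots,d\}$ is a coclique, then $\sum_{i\in C}c_i\le 1$.
   Context: Write the ordering as $\epsilon_0<\epsilon_1<\dots<\epsilon_{2d-1}$. Each occupied site carries a rotor pointing in one of the directions $\epsilon_j$. The growth process starts with no sites occupied; each particle is placed at the origin, and while it is at an occupied site $x$ it moves to $x+(\text{rotor direction at }x)$ and the rotor at $x$ is then advanced to the next direction in the cyclic order $\epsilon_0\to\epsilon_1\to\dots\to\epsilon_{2d-1}\to\epsilon_0$; when it reaches an unoccupied site it stops there, and that site becomes occupied with rotor $\epsilon_0$ (in particular the first particle occupies the origin). A set $C\subset\{1,\dots,d\}$ is a coclique if the sets $\{\epsilon\in E_d: e_i<\epsilon\le -e_i\}$, $i\in C$, are pairwise disjoint. *)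

theory Defs
  imports "HOL-Analysis.Analysis" "HOL-Library.While_Combinator"
begin

definition directions :: "(int ^ 'd) set" where
  "directions = range (\<lambda>i. axis i 1) \<union> range (\<lambda>i. - axis i 1)"

text \<open>Strict orders are given as relations: \<open>(a, b) \<in> lt\<close> means \<open>a < b\<close>, so that
  \<open>(a, b) \<in> lt\<^sup>=\<close> means \<open>a \<le> b\<close>. The enumeration below writes the ordering as
  \<open>\<epsilon> 0 < \<epsilon> 1 < \<dots> < \<epsilon> (2 * CARD('d) - 1)\<close>; values of \<open>\<epsilon>\<close> at larger indices are irrelevant.\<close>

definition enumerates_directions ::
    "((int ^ 'd) \<times> (int ^ 'd)) set \<Rightarrow> (nat \<Rightarrow> int ^ 'd) \<Rightarrow> bool" where
  "enumerates_directions lt \<epsilon> \<longleftrightarrow>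
     bij_betw \<epsilon> {..<2 * CARD('d)} directions \<and>
     (\<forall>j k. j < k \<and> k < 2 * CARD('d) \<longrightarrow> (\<epsilon> j, \<epsilon> k) \<in> lt)"

definition coclique :: "((int ^ 'd) \<times> (int ^ 'd)) set \<Rightarrow> 'd set \<Rightarrow> bool" where
  "coclique lt C \<longleftrightarrow>
     disjoint_family_on
       (\<lambda>i. {e \<in> directions. (axis i 1, e) \<in> lt \<and> (e, - axis i 1) \<in> lt\<^sup>=}) C"

text \<open>The domain of a configuration is the set of occupied sites; \<open>\<sigma> x = Some j\<close> means
  that \<open>x\<close> carries a rotor pointing in direction \<open>\<epsilon> j\<close>.\<close>

type_synonym 'd rotor_config = "(int ^ 'd) \<rightharpoonup> nat"

definition rotor_step ::
    "(nat \<Rightarrow> int ^ 'd) \<Rightarrow> 'd rotor_config \<times> (int ^ 'd) \<Rightarrow> 'd rotor_config \<times> (int ^ 'd)" where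
  "rotor_step \<epsilon> = (\<lambda>(\<sigma>, x).
     (\<sigma>(x \<mapsto> Suc (the (\<sigma> x)) mod (2 * CARD('d))), x + \<epsilon> (the (\<sigma> x))))"

text \<open>If the walk never left the occupied sites, the value of \<open>while\<close> would be unspecified;
  statements about \<open>deposit\<close> thus depend on the fact that every walk terminates.\<close>

definition deposit :: "(nat \<Rightarrow> int ^ 'd) \<Rightarrow> 'd rotor_config \<Rightarrow> 'd rotor_config" where
  "deposit \<epsilon> \<sigma> =
     (let (\<sigma>', x) = while (\<lambda>(\<tau>, y). y \<in> dom \<tau>) (rotor_step \<epsilon>) (\<sigma>, 0) in \<sigma>'(x \<mapsto> 0))"

definition occupied :: "(nat \<Rightarrow> int ^ 'd) \<Rightarrow> nat \<Rightarrow> (int ^ 'd) set" where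
  "occupied \<epsilon> n = dom ((deposit \<epsilon> ^^ n) Map.empty)"

definition center_of_mass :: "(int ^ 'd) set \<Rightarrow> real ^ 'd" where
  "center_of_mass A = (\<Sum>x\<in>A. \<chi> i. real_of_int (x $ i)) /\<^sub>R real (card A)"

end

theory Submission
  imports Defs
begin

text \<open>Let \<open>w j = \<epsilon> 0 + \<dots> + \<epsilon> (j - 1)\<close>. A move of the particle out of a site whose rotor is in state
  \<open>j\<close> changes both its position and \<open>w\<close> of the rotor by \<open>\<epsilon> j\<close> (a full turn contributes \<open>0\<close>), so the
  sum of the occupied sites always equals the sum of \<open>w\<close> over all rotors. Thus the center of mass is
  an average of the vectors \<open>w j\<close>, and the \<open>i\<close>-th coordinate of \<open>w j\<close> is \<open>1\<close> if
  \<open>axis i 1 < \<epsilon> j \<le> - axis i 1\<close> and \<open>0\<close> otherwise.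

  For termination, the same bookkeeping with the increments of \<open>|x|\<^sup>2 - t\<close> shows that
  \<open>|x|\<^sup>2 - 2 * (\<Sum>y. y \<bullet> w (\<sigma> y))\<close> grows by exactly \<open>1\<close> in each step, while it is bounded as long as
  the particle stays in a fixed finite set.\<close>

section \<open>Rotor configurations and weighted sums over their rotors\<close>

definition valid_config :: "'d::finite rotor_config \<Rightarrow> bool" where
  "valid_config \<sigma> \<longleftrightarrow> finite (dom \<sigma>) \<and> ran \<sigma> \<subseteq> {..<2 * CARD('d)}"

text \<open>The weight may depend on the site: \<open>g y k = \<epsilon> k\<close> gives the sum of
  the vectors \<open>w\<close>, and a weight linear in \<open>y\<close> gives the correction term of
  the termination argument.\<close>

definition rotor_sum ::
    "(int ^ 'd \<Rightarrow> nat \<Rightarrow> 'b::comm_monoid_add) \<Rightarrow> 'd rotor_config \<Rightarrow> 'b" where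
  "rotor_sum g \<sigma> = (\<Sum>y\<in>dom \<sigma>. \<Sum>k<the (\<sigma> y). g y k)"

lemma valid_config_state_less:
  fixes \<sigma> :: "'d::finite rotor_config"
  assumes "valid_config \<sigma>" "x \<in> dom \<sigma>"
  shows "the (\<sigma> x) < 2 * CARD('d)"
  using assms by (auto simp: valid_config_def ran_def)

lemma valid_config_upd:
  fixes \<sigma> :: "'d::finite rotor_config"
  assumes "valid_config \<sigma>" "j < 2 * CARD('d)"
  shows "valid_config (\<sigma>(x \<mapsto> j))"
  using assms by (auto simp: valid_config_def ran_def split: if_splits)

text \<open>Only the wrap-around needs care: resetting the last state to \<open>0\<close> discards
  the first \<open>2 * CARD('d) - 1\<close> weights, which amounts to adding the last one because a
  full turn sums to \<open>0\<close>.\<close>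

lemma rotor_sum_advance:
  fixes \<sigma> :: "'d::finite rotor_config"
    and g :: "int ^ 'd \<Rightarrow> nat \<Rightarrow> 'b::ab_group_add"
  assumes v: "valid_config \<sigma>" and x: "x \<in> dom \<sigma>"
    and g: "(\<Sum>k<2 * CARD('d). g x k) = 0"
  shows "rotor_sum g (\<sigma>(x \<mapsto> Suc (the (\<sigma> x)) mod (2 * CARD('d)))) =
         rotor_sum g \<sigma> + g x (the (\<sigma> x))"
proof -
  let ?m = "2 * CARD('d)" and ?j = "the (\<sigma> x)"
  have fin: "finite (dom \<sigma>)" using v by (simp add: valid_config_def)
  have turn: "(\<Sum>k<Suc ?j mod ?m. g x k) = (\<Sum>k<?j. g x k) + g x ?j"
  proof (cases "Suc ?j = ?m")
    case True
    have "(\<Sum>k<?j. g x k) + g x ?j = (\<Sum>k<Suc ?j. g x k)" by simp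
    also have "\<dots> = 0" unfolding True by (rule g)
    finally show ?thesis using True by simp
  next
    case False
    then have "Suc ?j < ?m" using valid_config_state_less[OF v x] by simp
    then show ?thesis by simp
  qed
  have "rotor_sum g (\<sigma>(x \<mapsto> Suc ?j mod ?m)) =
      (\<Sum>k<Suc ?j mod ?m. g x k) + (\<Sum>y\<in>dom \<sigma> - {x}. \<Sum>k<the (\<sigma> y). g y k)"
    using x fin by (simp add: rotor_sum_def insert_absorb sum.remove)
  also have "\<dots> = rotor_sum g \<sigma> + g x ?j"
    unfolding turn rotor_sum_def using sum.remove[OF fin x, of "\<lambda>y. \<Sum>k<the (\<sigma> y). g y k"]
    by (simp add: algebra_simps)
  finally show ?thesis .
qed

lemma rotor_sum_insert:
  fixes \<sigma> :: "'d::finite rotor_config"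
  assumes "finite (dom \<sigma>)" "x \<notin> dom \<sigma>"
  shows "rotor_sum g (\<sigma>(x \<mapsto> 0)) = rotor_sum g \<sigma>"
proof -
  have "(\<Sum>y\<in>dom \<sigma>. \<Sum>k<the ((\<sigma>(x \<mapsto> 0)) y). g y k) = rotor_sum g \<sigma>"
    unfolding rotor_sum_def using assms(2) by (intro sum.cong) auto
  then show ?thesis
    using assms by (simp add: rotor_sum_def del: fun_upd_apply) simp
qed

text \<open>The bound depends on the domain alone, not on the rotor states, so it stays the same
  throughout a walk on a fixed domain.\<close>

lemma rotor_sum_bounded:
  fixes \<sigma> :: "'d::finite rotor_config" and g :: "int ^ 'd \<Rightarrow> nat \<Rightarrow> int"
  assumes "valid_config \<sigma>"
  shows "\<bar>rotor_sum g \<sigma>\<bar> \<le> (\<Sum>y\<in>dom \<sigma>. \<Sum>k<2 * CARD('d). \<bar>g y k\<bar>)"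
proof -
  have "\<bar>\<Sum>k<the (\<sigma> y). g y k\<bar> \<le> (\<Sum>k<2 * CARD('d). \<bar>g y k\<bar>)" if "y \<in> dom \<sigma>" for y
  proof -
    have "\<bar>\<Sum>k<the (\<sigma> y). g y k\<bar> \<le> (\<Sum>k<the (\<sigma> y). \<bar>g y k\<bar>)" by (rule sum_abs)
    also have "\<dots> \<le> (\<Sum>k<2 * CARD('d). \<bar>g y k\<bar>)"
      using valid_config_state_less[OF assms that] by (intro sum_mono2) auto
    finally show ?thesis .
  qed
  then show ?thesis
    unfolding rotor_sum_def by (rule order.trans[OF sum_abs sum_mono])
qed

section \<open>The set of directions\<close>

text \<open>Negation permutes the directions, so the sum equals its own negative; coordinatewise
  this forces \<open>0\<close> in the integers.\<close>

lemma sum_directions: "(\<Sum>e\<in>directions. e) = (0 :: int ^ 'd::finite)"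
proof -
  have "(\<Sum>e\<in>directions. e) = (\<Sum>e\<in>directions. - e :: int ^ 'd)"
    by (rule sum.reindex_bij_witness[of _ uminus uminus]) (auto simp: directions_def)
  then have *: "(\<Sum>e\<in>directions. e) = - (\<Sum>e\<in>directions. e :: int ^ 'd)"
    by (simp add: sum_negf)
  show ?thesis
  proof (rule vec_eq_iff[THEN iffD2], rule allI)
    fix i :: 'd
    show "(\<Sum>e\<in>directions. e) $ i = (0 :: int ^ 'd) $ i"
      using arg_cong[OF *, of "\<lambda>v. v $ i"] by simp
  qed
qed

lemma sum_square_direction:
  fixes e :: "int ^ 'd::finite"
  assumes "e \<in> directions"
  shows "(\<Sum>i\<in>UNIV. (e $ i)\<^sup>2) = 1"
proof -
  from assms obtain a where "e = axis a 1 \<or> e = - axis a 1"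
    by (auto simp: directions_def)
  then have "(e $ i)\<^sup>2 = (if i = a then 1 else 0)" for i
    by (auto simp: axis_def)
  then show ?thesis by simp
qed

section \<open>One deposited particle: termination and balance\<close>

text \<open>While the particle moves, its position is added to the sum of the occupied sites. It
  starts at \<open>0\<close>, contributing nothing, and its final position becomes the new site,
  whose rotor state \<open>0\<close> adds nothing to the rotor sum.\<close>

lemma deposit_preserves_balance:
  fixes \<epsilon> :: "nat \<Rightarrow> int ^ 'd::finite"
  assumes bij: "bij_betw \<epsilon> {..<2 * CARD('d)} directions"
    and v: "valid_config \<sigma>" and bal: "\<Sum>(dom \<sigma>) = rotor_sum (\<lambda>y. \<epsilon>) \<sigma>"
  shows "valid_config (deposit \<epsilon> \<sigma>) \<and>
         \<Sum>(dom (deposit \<epsilon> \<sigma>)) = rotor_sum (\<lambda>y. \<epsilon>) (deposit \<epsilon> \<sigma>)"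
proof -
  define nsq :: "int ^ 'd \<Rightarrow> int" where "nsq y = (\<Sum>i\<in>UNIV. (y $ i)\<^sup>2)" for y
  \<comment> \<open>The part of \<open>nsq (y + \<epsilon> k) - nsq y\<close> that is linear in
    \<open>\<epsilon> k\<close>; the remaining part, \<open>nsq (\<epsilon> k)\<close>, is
    \<open>1\<close> for every direction.\<close>
  define g :: "int ^ 'd \<Rightarrow> nat \<Rightarrow> int" where "g y k = (\<Sum>i\<in>UNIV. 2 * (y $ i * \<epsilon> k $ i))" for y k
  define \<Phi> where "\<Phi> = (\<lambda>(\<tau>, y). nsq y - rotor_sum g \<tau>)"
  \<comment> \<open>Exceeds \<open>\<Phi>\<close> whenever the particle is on an occupied site:
    \<open>nsq y\<close> is then a summand of the first sum, the second bounds the rotor sum, and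
    the \<open>1\<close> makes the inequality strict.\<close>
  define B where
    "B = 1 + (\<Sum>y\<in>dom \<sigma>. nsq y) + (\<Sum>y\<in>dom \<sigma>. \<Sum>k<2 * CARD('d). \<bar>g y k\<bar>)"
  define P where "P = (\<lambda>(\<tau>, y). valid_config \<tau> \<and> dom \<tau> = dom \<sigma> \<and>
    \<Sum>(dom \<sigma>) + y = rotor_sum (\<lambda>y. \<epsilon>) \<tau>)"
  have sum0: "(\<Sum>k<2 * CARD('d). \<epsilon> k) = 0"
    using sum.reindex_bij_betw[OF bij, of "\<lambda>e. e"] sum_directions by simp
  have g0: "(\<Sum>k<2 * CARD('d). g y k) = 0" for y
  proof -
    have "(\<Sum>k<2 * CARD('d). g y k) = (\<Sum>i\<in>UNIV. 2 * (y $ i * (\<Sum>k<2 * CARD('d). \<epsilon> k) $ i))"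
      unfolding g_def by (subst sum.swap) (simp add: sum_distrib_left)
    then show ?thesis by (simp add: sum0)
  qed
  have nsq_add: "nsq (y + \<epsilon> k) = nsq y + g y k + 1" if "k < 2 * CARD('d)" for y k
  proof -
    have "nsq (y + \<epsilon> k) = nsq y + g y k + nsq (\<epsilon> k)"
      by (simp add: nsq_def g_def power2_sum sum.distrib algebra_simps)
    moreover have "\<epsilon> k \<in> directions" using bij that by (auto simp: bij_betw_def)
    ultimately show ?thesis using sum_square_direction[of "\<epsilon> k"] by (simp add: nsq_def)
  qed
  have step: "P (rotor_step \<epsilon> s) \<and> \<Phi> (rotor_step \<epsilon> s) = \<Phi> s + 1 \<and> \<Phi> s < B"
    if "P s" "case s of (\<tau>, y) \<Rightarrow> y \<in> dom \<tau>" for s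
  proof -
    obtain \<tau> y where s: "s = (\<tau>, y)" by (cases s)
    have v': "valid_config \<tau>" and d: "dom \<tau> = dom \<sigma>" and y: "y \<in> dom \<tau>"
      and b: "\<Sum>(dom \<sigma>) + y = rotor_sum (\<lambda>y. \<epsilon>) \<tau>"
      using that by (auto simp: s P_def)
    let ?\<tau> = "\<tau>(y \<mapsto> Suc (the (\<tau> y)) mod (2 * CARD('d)))"
    have rs: "rotor_step \<epsilon> s = (?\<tau>, y + \<epsilon> (the (\<tau> y)))"
      by (simp add: s rotor_step_def)
    have "valid_config ?\<tau>" by (intro valid_config_upd v') simp
    moreover have "dom ?\<tau> = dom \<sigma>" using y d by auto
    moreover have "\<Sum>(dom \<sigma>) + (y + \<epsilon> (the (\<tau> y))) = rotor_sum (\<lambda>y. \<epsilon>) ?\<tau>"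
      using rotor_sum_advance[OF v' y, of "\<lambda>y. \<epsilon>"] sum0 b by (simp add: add.assoc[symmetric])
    moreover have "\<Phi> (rotor_step \<epsilon> s) = \<Phi> s + 1"
      unfolding rs using rotor_sum_advance[OF v' y, of g] g0
        nsq_add[OF valid_config_state_less[OF v' y]] by (simp add: \<Phi>_def s)
    moreover have "nsq y \<le> (\<Sum>y\<in>dom \<sigma>. nsq y)"
      using y d v by (intro member_le_sum) (auto simp: nsq_def valid_config_def sum_nonneg)
    then have "\<Phi> s < B"
      using rotor_sum_bounded[OF v', of g] by (simp add: \<Phi>_def s B_def d)
    ultimately show ?thesis by (simp add: rs P_def)
  qed
  let ?b = "\<lambda>(\<tau>, y). y \<in> dom \<tau>"
  \<comment> \<open>Before each move \<open>\<Phi> s < B\<close>, so \<open>B - \<Phi> s\<close> is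
    positive and its image under \<open>nat\<close> drops strictly.\<close>
  have "case while ?b (rotor_step \<epsilon>) (\<sigma>, 0) of (\<tau>, y) \<Rightarrow> P (\<tau>, y) \<and> y \<notin> dom \<tau>"
  proof (rule while_rule[where P = P and r = "Wellfounded.measure (\<lambda>s. nat (B - \<Phi> s))"])
    show "P (\<sigma>, 0)" using v bal by (simp add: P_def)
  next
    fix s assume "P s" "?b s"
    from step[OF this] show "P (rotor_step \<epsilon> s)"
      and "(rotor_step \<epsilon> s, s) \<in> Wellfounded.measure (\<lambda>s. nat (B - \<Phi> s))" by auto
  qed auto
  moreover obtain \<tau> y where w: "while ?b (rotor_step \<epsilon>) (\<sigma>, 0) = (\<tau>, y)"
    by (cases "while ?b (rotor_step \<epsilon>) (\<sigma>, 0)")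
  ultimately have v': "valid_config \<tau>" and d: "dom \<tau> = dom \<sigma>" and y: "y \<notin> dom \<tau>"
    and b: "\<Sum>(dom \<sigma>) + y = rotor_sum (\<lambda>y. \<epsilon>) \<tau>"
    by (auto simp: P_def)
  have dep: "deposit \<epsilon> \<sigma> = \<tau>(y \<mapsto> 0)" by (simp add: deposit_def w)
  have fin: "finite (dom \<tau>)" using v' by (simp add: valid_config_def)
  have "valid_config (\<tau>(y \<mapsto> 0))" by (intro valid_config_upd v') simp
  moreover have "\<Sum>(dom (\<tau>(y \<mapsto> 0))) = rotor_sum (\<lambda>y. \<epsilon>) (\<tau>(y \<mapsto> 0))"
    unfolding rotor_sum_insert[OF fin y] using b fin y d by (simp add: add.commute)
  ultimately show ?thesis by (simp add: dep)
qed

lemma deposits_balance: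
  fixes \<epsilon> :: "nat \<Rightarrow> int ^ 'd::finite"
  assumes "bij_betw \<epsilon> {..<2 * CARD('d)} directions"
  defines "\<sigma> n \<equiv> (deposit \<epsilon> ^^ n) Map.empty"
  shows "valid_config (\<sigma> n) \<and> \<Sum>(dom (\<sigma> n)) = rotor_sum (\<lambda>y. \<epsilon>) (\<sigma> n)"
proof (induction n)
  case 0
  show ?case by (simp add: \<sigma>_def valid_config_def rotor_sum_def)
next
  case (Suc n)
  then show ?case
    using deposit_preserves_balance[OF assms(1)] by (simp add: \<sigma>_def)
qed

section \<open>From balance to the center of mass\<close>

text \<open>Balance turns the total over \<open>C\<close> of the coordinates of all occupied sites
  into a sum with one term per rotor, each in \<open>{0..1}\<close> by hypothesis. Singletons
  \<open>C\<close> yield the bounds on single coordinates.\<close>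

lemma center_of_mass_sum_bounds:
  fixes \<epsilon> :: "nat \<Rightarrow> int ^ 'd::finite"
  assumes "bij_betw \<epsilon> {..<2 * CARD('d)} directions"
    and w: "\<And>j. j < 2 * CARD('d) \<Longrightarrow> (\<Sum>i\<in>C. \<Sum>k<j. \<epsilon> k $ i) \<in> {0..1}"
  shows "(\<Sum>i\<in>C. center_of_mass (occupied \<epsilon> n) $ i) \<in> {0..1}"
proof -
  define \<sigma> where "\<sigma> = (deposit \<epsilon> ^^ n) Map.empty"
  have v: "valid_config \<sigma>" and bal: "\<Sum>(dom \<sigma>) = rotor_sum (\<lambda>y. \<epsilon>) \<sigma>"
    using deposits_balance[OF assms(1), of n] by (simp_all add: \<sigma>_def)
  define S where "S = (\<Sum>y\<in>dom \<sigma>. \<Sum>i\<in>C. \<Sum>k<the (\<sigma> y). \<epsilon> k $ i)"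
  have "(\<Sum>y\<in>dom \<sigma>. y $ i) = (\<Sum>y\<in>dom \<sigma>. \<Sum>k<the (\<sigma> y). \<epsilon> k $ i)" for i
    using arg_cong[OF bal, of "\<lambda>v. v $ i"] by (simp add: rotor_sum_def)
  then have S: "S = (\<Sum>i\<in>C. \<Sum>y\<in>dom \<sigma>. y $ i)"
    unfolding S_def by (subst sum.swap) simp
  have "0 \<le> S"
    unfolding S_def by (rule sum_nonneg) (use w[OF valid_config_state_less[OF v]] in simp)
  moreover have "S \<le> int (card (dom \<sigma>))"
    using w[OF valid_config_state_less[OF v]]
      sum_bounded_above[of "dom \<sigma>" "\<lambda>y. \<Sum>i\<in>C. \<Sum>k<the (\<sigma> y). \<epsilon> k $ i" 1]
    by (simp add: S_def)
  ultimately have "real_of_int S \<in> {0..real (card (dom \<sigma>))}" by auto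
  moreover have "(\<Sum>i\<in>C. center_of_mass (occupied \<epsilon> n) $ i) = real_of_int S / real (card (dom \<sigma>))"
    unfolding S center_of_mass_def occupied_def \<sigma>_def[symmetric]
    by (simp add: sum_distrib_left[symmetric] divide_inverse mult.commute)
  \<comment> \<open>An empty \<open>dom \<sigma>\<close> gives \<open>0 / 0 = 0\<close>, which lies
    in the interval as well.\<close>
  ultimately show ?thesis by (auto simp: divide_le_eq_1)
qed

theorem theorem4p1:
  fixes lt :: "((int, 'd::{finite,linorder}) vec \<times> (int, 'd) vec) set"
    and \<epsilon> :: "nat \<Rightarrow> (int, 'd) vec"
    and n :: nat
  assumes "strict_linear_order_on directions lt"
    and "\<And>i j :: 'd. i < j \<Longrightarrow> (axis i 1, axis j 1) \<in> lt"
    and "\<And>i :: 'd. (axis i 1, - axis i 1) \<in> lt"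
    and "enumerates_directions lt \<epsilon>"
    and "n \<ge> 1"
  shows "(\<forall>i. 0 \<le> center_of_mass (occupied \<epsilon> n) $ i \<and>
              center_of_mass (occupied \<epsilon> n) $ i \<le> 1) \<and>
         (\<forall>C. coclique lt C \<longrightarrow> (\<Sum>i\<in>C. center_of_mass (occupied \<epsilon> n) $ i) \<le> 1)"
proof -
  let ?m = "2 * CARD('d)"
  have bij: "bij_betw \<epsilon> {..<?m} directions"
    and lt: "\<And>j k. j < k \<Longrightarrow> k < ?m \<Longrightarrow> (\<epsilon> j, \<epsilon> k) \<in> lt"
    using assms(4) by (auto simp: enumerates_directions_def)
  have inj: "inj_on \<epsilon> {..<?m}" using bij by (simp add: bij_betw_def)
  have tr: "trans lt" and irr: "irrefl lt"
    using assms(1) by (auto simp: strict_linear_order_on_def)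
  have "\<exists>p q. p < q \<and> q < ?m \<and> \<epsilon> p = axis i 1 \<and> \<epsilon> q = - axis i 1" for i
  proof -
    have "axis i 1 \<in> \<epsilon> ` {..<?m}" "- axis i 1 \<in> \<epsilon> ` {..<?m}"
      using bij by (auto simp: bij_betw_def directions_def)
    then obtain p q where pq: "p < ?m" "q < ?m" "\<epsilon> p = axis i 1" "\<epsilon> q = - axis i 1"
      by (metis imageE lessThan_iff)
    have "(\<epsilon> p, \<epsilon> q) \<in> lt" using assms(3)[of i] pq by simp
    then have "\<not> q < p" "p \<noteq> q"
      using lt[of q p] pq(1) tr irr by (auto simp: irrefl_def dest: transD)
    then show ?thesis using pq by (metis linorder_neqE_nat)
  qed
  then obtain p q where pq: "\<And>i. p i < q i" "\<And>i. q i < ?m"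
      "\<And>i. \<epsilon> (p i) = axis i 1" "\<And>i. \<epsilon> (q i) = - axis i 1"
    by metis
  have coord: "\<epsilon> k $ i = (if k = p i then 1 else 0) - (if k = q i then 1 else 0)"
    if k: "k < ?m" for k i
  proof (cases "k = p i \<or> k = q i")
    case True
    then show ?thesis using pq(1)[of i] pq(3,4) by auto
  next
    case False
    have "p i < ?m" using pq(1,2)[of i] by linarith
    then have "\<epsilon> k \<noteq> axis i 1" "\<epsilon> k \<noteq> - axis i 1"
      using False inj_onD[OF inj, of k "p i"] inj_onD[OF inj, of k "q i"] k pq(2-4) by auto
    moreover have "\<epsilon> k \<in> directions" using bij k by (auto simp: bij_betw_def)
    ultimately show ?thesis using False by (auto simp: directions_def axis_def)
  qed
  \<comment> \<open>The sum stops before index \<open>j\<close>: the \<open>1\<close> at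
    \<open>p i\<close> counts once \<open>p i < j\<close> and is cancelled only once
    \<open>q i < j\<close>. Hence the interval is open on the left and closed on the right, as in
    \<open>coclique\<close>.\<close>
  have partial: "(\<Sum>k<j. \<epsilon> k $ i) = (if p i < j \<and> j \<le> q i then 1 else 0)" if "j < ?m" for i j
  proof -
    have "(\<Sum>k<j. \<epsilon> k $ i) =
        (\<Sum>k<j. (if k = p i then 1 else 0) - (if k = q i then 1 else 0))"
      using that by (intro sum.cong) (auto simp: coord)
    also have "\<dots> = (if p i < j \<and> j \<le> q i then 1 else 0)"
      using pq(1)[of i] by (auto simp: sum_subtractf)
    finally show ?thesis .
  qed
  have "(\<Sum>i'\<in>{i}. center_of_mass (occupied \<epsilon> n) $ i') \<in> {0..1}" for i
    by (rule center_of_mass_sum_bounds[OF bij]) (simp add: partial)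
  moreover have "(\<Sum>i\<in>C. center_of_mass (occupied \<epsilon> n) $ i) \<in> {0..1}" if C: "coclique lt C" for C
  proof (rule center_of_mass_sum_bounds[OF bij])
    fix j assume j: "j < ?m"
    have mem: "\<epsilon> j \<in> {e \<in> directions. (axis i 1, e) \<in> lt \<and> (e, - axis i 1) \<in> lt\<^sup>=}"
      if "p i < j" "j \<le> q i" for i
    proof -
      have "\<epsilon> j \<in> directions" using bij j by (auto simp: bij_betw_def)
      moreover have "(axis i 1, \<epsilon> j) \<in> lt" using lt[OF that(1) j] by (simp add: pq)
      moreover have "(\<epsilon> j, - axis i 1) \<in> lt\<^sup>="
        using lt[OF _ pq(2), of j i] that(2) pq(4)[of i] by (cases "j = q i") auto
      ultimately show ?thesis by blast
    qed
    \<comment> \<open>Every index in \<open>C\<close> with a nonzero partial sum has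
      \<open>\<epsilon> j\<close> in its interval, so disjointness leaves at most one such
      index.\<close>
    have eq: "i = i'" if "i \<in> C" "i' \<in> C" "p i < j \<and> j \<le> q i" "p i' < j \<and> j \<le> q i'" for i i'
      using C mem[of i] mem[of i'] that unfolding coclique_def disjoint_family_on_def by blast
    have "card {i \<in> C. p i < j \<and> j \<le> q i} \<le> Suc 0"
      by (subst card_le_Suc0_iff_eq) (auto intro: eq)
    moreover have "(\<Sum>i\<in>C. \<Sum>k<j. \<epsilon> k $ i) = int (card {i \<in> C. p i < j \<and> j \<le> q i})"
      using j by (simp add: partial sum.inter_filter[symmetric])
    ultimately show "(\<Sum>i\<in>C. \<Sum>k<j. \<epsilon> k $ i) \<in> {0..1}" by simp
  qed
  ultimately show ?thesis by auto
qed

end
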